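(* Let $\mathcal{R}$ be an almost surely terminating probabilistic De Simone specification over a signature $\Sigma$ and label set $L$, with operational model $\gamma\colon\mu\Sigma\to\mathcal{W}(L\times\mu\Sigma+1)$ and trace map $\mathsf{tr}\colon\mu\Sigma\to\mathcal{W}(L^{*})$. Then trace equivalence ($t\equiv s$ iff $\mathsf{tr}(t)=\mathsf{tr}(s)$) is a congruence on $\mu\Sigma$: for every $n$-ary $f\in\Sigma$ and closed terms with $t_i\equiv s_i$ ($i=1,\dots,n$), $f(t_1,\dots,t_n)\equiv f(s_1,\dots,s_n)$.
   Context: $\mathcal{W}X=[0,\infty]^X$ (formal sums $\sum_i r_i\cdot x_i$), $\mathcal{D}X\subseteq\mathcal{W}X$ the probability distributions. $\mu\Sigma$ is the set of closed $\Sigma$-terms. Weighted De Simone rules (variables $x_i,y_i$): (I) premises $x_{i_1}\xrightarrow{a_1}y_{i_1},\dots,x_{i_k}\xrightarrow{a_k}y_{i_k}$, $x_{j_1}\to*,\dots,x_{j_m}\to*$, conclusion $f(x_1,\dots,x_n)\xrightarrow{a/r}t$; (II) same premises, conclusion $f(x_1,\dots,x_n)\xrightarrow{r}*$; here $f\in\Sigma$ is $n$-ary, the indices $i_1,\dots,i_k,j_1,\dots,j_m\in\{1,\dots,n\}$ are pairwise distinct, $a_l,a\in L$, $r\in[0,\infty]$, and $t$ is an affine term (no variable occurring twice) in the variables $y_{i_l}$ and $x_j$ for $j\notin\{i_1,\dots,i_k,j_1,\dots,j_m\}$. Operational model $\gamma$, by structural recursion: $\gamma(f(t_1,\dots,t_n))=\sum_{R\text{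 rule for }f}\gamma_R(f(t_1,\dots,t_n))$, where for $R$ of type (I), $\gamma_R=\sum_{s_{i_1},\dots,s_{i_k}\in\mu\Sigma}r\cdot\prod_{l=1}^k\gamma(t_{i_l})(a_l,s_{i_l})\cdot\prod_{l=1}^m\gamma(t_{j_l})( * )\cdot(a,t[\sigma])$, $\sigma\colon x_i\mapsto t_i$, $y_{i_l}\mapsto s_{i_l}$, and for type (II) the same with $(a,t[\sigma])$ replaced by $*$. A probabilistic De Simone specification is a set of such rules with $\gamma(t)\in\mathcal{D}(L\times\mu\Sigma+1)$ for all $t$. Trace map: $\mathsf{tr}(x)(a_1\cdots a_n)=\sum_{x=x_0,x_1,\dots,x_n}\big(\prod_{i=0}^{n-1}\gamma(x_i)(a_{i+1},x_{i+1})\big)\cdot\gamma(x_n)( * )$, summing over all sequences of closed terms starting at $x$. The specification is almost surely terminating if $\mathsf{tr}(t)\in\mathcal{D}(L^{*})$ for all $t\in\mu\Sigma$. *)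

theory Defs
  imports "HOL-Analysis.Infinite_Sum" "HOL-Library.Extended_Nonnegative_Real" "HOL-Library.FuncSet"
begin

text \<open>
  A signature is a type \<open>'f\<close> of operation symbols with an arity function \<open>ar\<close>. Labels form
  the type \<open>'l\<close>. Argument positions are counted from 0, so the variables are
  \<open>x\<^sub>0, \<dots>, x\<^sub>n\<^sub>-\<^sub>1\<close> (\<open>VX i\<close>) and \<open>y\<^sub>0, \<dots>, y\<^sub>n\<^sub>-\<^sub>1\<close> (\<open>VY i\<close>).
\<close>

datatype var = VX nat | VY nat

datatype ('f, 'v) trm = Var 'v | Fn 'f "('f, 'v) trm list"

inductive_set terms :: "('f \<Rightarrow> nat) \<Rightarrow> 'v set \<Rightarrow> ('f, 'v) trm set"
  for ar :: "'f \<Rightarrow> nat" and V :: "'v set" where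
  Var: "v \<in> V \<Longrightarrow> Var v \<in> terms ar V"
| Fn: "length ts = ar f \<Longrightarrow> (\<And>t. t \<in> set ts \<Longrightarrow> t \<in> terms ar V) \<Longrightarrow> Fn f ts \<in> terms ar V"

definition closed_terms :: "('f \<Rightarrow> nat) \<Rightarrow> ('f, var) trm set" where
  "closed_terms ar = terms ar {}"

primrec var_list :: "('f, 'v) trm \<Rightarrow> 'v list" where
  "var_list (Var v) = [v]"
| "var_list (Fn f ts) = concat (map var_list ts)"

definition affine_term :: "('f, 'v) trm \<Rightarrow> bool" where
  "affine_term t \<longleftrightarrow> distinct (var_list t)"

primrec subst :: "('v \<Rightarrow> ('f, 'w) trm) \<Rightarrow> ('f, 'v) trm \<Rightarrow> ('f, 'w) trm" where
  "subst \<sigma> (Var v) = \<sigma> v"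
| "subst \<sigma> (Fn f ts) = Fn f (map (subst \<sigma>) ts)"

text \<open>
  An element of \<open>L \<times> Z + 1\<close> is an option value, \<open>None\<close> being the termination symbol \<open>*\<close>.
  In a rule, \<open>acts\<close> maps \<open>i\<^sub>l\<close> to \<open>a\<^sub>l\<close> and is undefined elsewhere, and \<open>stops\<close> is
  \<open>{j\<^sub>1, \<dots>, j\<^sub>m}\<close>; rules that differ only in the order of their premises are thus identified.
  The conclusion is \<open>Some (a, t)\<close> for rules of type (I) and \<open>None\<close> for rules of type (II).
\<close>

datatype ('f, 'l) ds_rule = DS_Rule
  (head: 'f)
  (acts: "nat \<rightharpoonup> 'l")
  (stops: "nat set")
  (weight: ennreal)
  (concl: "('l \<times> ('f, var) trm) option")

text \<open>Disjointness of \<open>dom (acts \<rho>)\<close> and \<open>stops \<rho>\<close> is the pairwise distinctness of the indices.\<close>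

definition de_simone_rule :: "('f \<Rightarrow> nat) \<Rightarrow> ('f, 'l) ds_rule \<Rightarrow> bool" where
  "de_simone_rule ar \<rho> \<longleftrightarrow>
     dom (acts \<rho>) \<subseteq> {..<ar (head \<rho>)} \<and>
     stops \<rho> \<subseteq> {..<ar (head \<rho>)} \<and>
     dom (acts \<rho>) \<inter> stops \<rho> = {} \<and>
     (\<forall>a t. concl \<rho> = Some (a, t) \<longrightarrow>
        affine_term t \<and>
        t \<in> terms ar (VY ` dom (acts \<rho>) \<union>
                        VX ` ({..<ar (head \<rho>)} - (dom (acts \<rho>) \<union> stops \<rho>))))"

primrec rule_subst ::
  "('f, var) trm list \<Rightarrow> (nat \<Rightarrow> ('f, var) trm) \<Rightarrow> var \<Rightarrow> ('f, var) trm" where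
  "rule_subst ts s (VX i) = ts ! i"
| "rule_subst ts s (VY i) = s i"

text \<open>
  The contribution \<open>\<gamma>\<^sub>R(f(t\<^sub>1, \<dots>, t\<^sub>n))\<close> of a rule, as a function of \<open>ts\<close> and of the values
  \<open>g i = \<gamma>(t\<^sub>i)\<close>. The formal sum is evaluated coefficientwise at \<open>z\<close>.
\<close>

definition rule_model ::
  "('f \<Rightarrow> nat) \<Rightarrow> ('f, 'l) ds_rule \<Rightarrow> ('f, var) trm list \<Rightarrow>
   (nat \<Rightarrow> ('l \<times> ('f, var) trm) option \<Rightarrow> ennreal) \<Rightarrow> ('l \<times> ('f, var) trm) option \<Rightarrow> ennreal" where
  "rule_model ar \<rho> ts g z =
     (\<Sum>\<^sub>\<infinity>s \<in> dom (acts \<rho>) \<rightarrow>\<^sub>E closed_terms ar.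
        if z = map_option (\<lambda>(a, t). (a, subst (rule_subst ts s) t)) (concl \<rho>)
        then weight \<rho> * (\<Prod>i\<in>dom (acts \<rho>). g i (Some (the (acts \<rho> i), s i)))
                      * (\<Prod>j\<in>stops \<rho>. g j None)
        else 0)"

primrec op_model ::
  "('f \<Rightarrow> nat) \<Rightarrow> ('f, 'l) ds_rule set \<Rightarrow> ('f, var) trm \<Rightarrow>
   ('l \<times> ('f, var) trm) option \<Rightarrow> ennreal" where
  "op_model ar R (Var v) = (\<lambda>z. 0)"
| "op_model ar R (Fn f ts) =
     (\<lambda>z. \<Sum>\<^sub>\<infinity>\<rho> \<in> {\<rho> \<in> R. head \<rho> = f}.
        rule_model ar \<rho> ts (\<lambda>i. map (op_model ar R) ts ! i) z)"

definition is_distribution :: "'a set \<Rightarrow> ('a \<Rightarrow> ennreal) \<Rightarrow> bool" where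
  "is_distribution A p \<longleftrightarrow> (\<Sum>\<^sub>\<infinity>x\<in>A. p x) = 1"

definition outcomes :: "('f \<Rightarrow> nat) \<Rightarrow> ('l \<times> ('f, var) trm) option set" where
  "outcomes ar = insert None (Some ` (UNIV \<times> closed_terms ar))"

definition prob_de_simone_spec :: "('f \<Rightarrow> nat) \<Rightarrow> ('f, 'l) ds_rule set \<Rightarrow> bool" where
  "prob_de_simone_spec ar R \<longleftrightarrow>
     (\<forall>\<rho>\<in>R. de_simone_rule ar \<rho>) \<and>
     (\<forall>t\<in>closed_terms ar. is_distribution (outcomes ar) (op_model ar R t))"

definition trace_map ::
  "('f \<Rightarrow> nat) \<Rightarrow> ('f, 'l) ds_rule set \<Rightarrow> ('f, var) trm \<Rightarrow> 'l list \<Rightarrow> ennreal" where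
  "trace_map ar R x w =
     (\<Sum>\<^sub>\<infinity>xs \<in> {xs. set xs \<subseteq> closed_terms ar \<and> length xs = Suc (length w) \<and> xs ! 0 = x}.
        (\<Prod>i<length w. op_model ar R (xs ! i) (Some (w ! i, xs ! Suc i)))
        * op_model ar R (xs ! length w) None)"

definition almost_surely_terminating :: "('f \<Rightarrow> nat) \<Rightarrow> ('f, 'l) ds_rule set \<Rightarrow> bool" where
  "almost_surely_terminating ar R \<longleftrightarrow>
     (\<forall>t\<in>closed_terms ar. is_distribution UNIV (trace_map ar R t))"

definition trace_equiv ::
  "('f \<Rightarrow> nat) \<Rightarrow> ('f, 'l) ds_rule set \<Rightarrow> (('f, var) trm \<times> ('f, var) trm) set" where
  "trace_equiv ar R =
     {(t, s). t \<in> closed_terms ar \<and> s \<in> closed_terms ar \<and> trace_map ar R t = trace_map ar R s}"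

definition congruence :: "('f \<Rightarrow> nat) \<Rightarrow> (('f, var) trm \<times> ('f, var) trm) set \<Rightarrow> bool" where
  "congruence ar E \<longleftrightarrow>
     equiv (closed_terms ar) E \<and>
     (\<forall>f ts ss. length ts = ar f \<and> length ss = ar f \<and> (\<forall>i<ar f. (ts ! i, ss ! i) \<in> E) \<longrightarrow>
        (Fn f ts, Fn f ss) \<in> E)"

text \<open>Each rule instance only looks at \<open>\<gamma>\<close> on the arguments, as in the informal recursion.\<close>

lemma op_model_Fn:
  assumes "\<forall>\<rho>\<in>R. de_simone_rule ar \<rho>" "length ts = ar f"
  shows "op_model ar R (Fn f ts) z =
    (\<Sum>\<^sub>\<infinity>\<rho> \<in> {\<rho> \<in> R. head \<rho> = f}. rule_model ar \<rho> ts (\<lambda>i. op_model ar R (ts ! i)) z)"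
proof -
  have "rule_model ar \<rho> ts (\<lambda>i. map (op_model ar R) ts ! i) z =
        rule_model ar \<rho> ts (\<lambda>i. op_model ar R (ts ! i)) z" if "\<rho> \<in> R" "head \<rho> = f" for \<rho>
  proof -
    have "de_simone_rule ar \<rho>" using assms(1) that(1) by blast
    then have "dom (acts \<rho>) \<union> stops \<rho> \<subseteq> {..<length ts}"
      using that(2) assms(2) by (simp add: de_simone_rule_def)
    then have *: "i < length ts" if "i \<in> dom (acts \<rho>) \<union> stops \<rho>" for i
      using that by blast
    have "(\<Prod>i\<in>dom (acts \<rho>). (map (op_model ar R) ts ! i) (Some (the (acts \<rho> i), s i))) =
          (\<Prod>i\<in>dom (acts \<rho>). op_model ar R (ts ! i) (Some (the (acts \<rho> i), s i)))" for s
      using * by (intro prod.cong) auto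
    moreover have "(\<Prod>j\<in>stops \<rho>. (map (op_model ar R) ts ! j) None) =
          (\<Prod>j\<in>stops \<rho>. op_model ar R (ts ! j) None)"
      using * by (intro prod.cong) auto
    ultimately show ?thesis unfolding rule_model_def by (simp only:)
  qed
  then show ?thesis by (auto intro!: infsum_cong)
qed

end

theory Submission
  imports Defs
begin

text \<open>
  Besides the probability of a complete trace \<open>w*\<close>, observe the probability of a trace prefix \<open>w\<close>.
  Almost sure termination makes the latter the sum of the probabilities of all traces extending
  \<open>w\<close>, so trace equivalent terms agree on all observations. Conversely, when one argument \<open>u\<close>
  of \<open>f(\<dots>, u, \<dots>)\<close> varies, every observation of \<open>f(\<dots>, u, \<dots>)\<close> is a fixed (infinite)
  linear combination of observations of \<open>u\<close>: a De Simone rule makes at most one step of \<open>u\<close>, and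
  because its target is affine, the residual of \<open>u\<close> again occurs at most once. The arguments
  are then exchanged one at a time.
\<close>

section \<open>Infinite sums of extended nonnegative reals\<close>

lemma infsum_Sigma_finite_ennreal:
  fixes f :: "'a \<times> 'b \<Rightarrow> ennreal"
  assumes "finite A"
  shows "infsum f (Sigma A B) = (\<Sum>x\<in>A. \<Sum>\<^sub>\<infinity>y\<in>B x. f (x, y))"
  using assms
proof (induction A)
  case (insert x A)
  have "Sigma (insert x A) B = Pair x ` B x \<union> Sigma A B" by auto
  moreover have "infsum f (Pair x ` B x) = (\<Sum>\<^sub>\<infinity>y\<in>B x. f (x, y))"
    by (subst infsum_reindex) (auto simp: inj_on_def o_def)
  ultimately show ?case
    using insert by (simp, subst infsum_Un_disjoint) (auto intro: nonneg_summable_on_complete)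
qed simp

text \<open>Tonelli for \<open>ennreal\<close>: a finite set of pairs lies over the finite set of
  its first components, so both inequalities reduce to a finite outer index set.\<close>

lemma infsum_Sigma_ennreal:
  fixes f :: "'a \<times> 'b \<Rightarrow> ennreal"
  shows "infsum f (Sigma A B) = (\<Sum>\<^sub>\<infinity>x\<in>A. \<Sum>\<^sub>\<infinity>y\<in>B x. f (x, y))"
proof (rule antisym)
  have "sum f F \<le> (\<Sum>\<^sub>\<infinity>x\<in>A. \<Sum>\<^sub>\<infinity>y\<in>B x. f (x, y))" if F: "finite F" "F \<subseteq> Sigma A B" for F
  proof -
    have "sum f F = infsum f F" using F by simp
    also have "\<dots> \<le> infsum f (Sigma (fst ` F) B)"
      using F by (intro infsum_mono_neutral nonneg_summable_on_complete) (auto intro: rev_image_eqI)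
    also have "\<dots> = (\<Sum>\<^sub>\<infinity>x\<in>fst ` F. \<Sum>\<^sub>\<infinity>y\<in>B x. f (x, y))"
      using F by (simp add: infsum_Sigma_finite_ennreal)
    also have "\<dots> \<le> (\<Sum>\<^sub>\<infinity>x\<in>A. \<Sum>\<^sub>\<infinity>y\<in>B x. f (x, y))"
      using F by (intro infsum_mono_neutral nonneg_summable_on_complete) auto
    finally show ?thesis .
  qed
  then show "infsum f (Sigma A B) \<le> (\<Sum>\<^sub>\<infinity>x\<in>A. \<Sum>\<^sub>\<infinity>y\<in>B x. f (x, y))"
    by (intro infsum_le_finite_sums nonneg_summable_on_complete) simp_all
  have "(\<Sum>x\<in>G. \<Sum>\<^sub>\<infinity>y\<in>B x. f (x, y)) \<le> infsum f (Sigma A B)" if "finite G" "G \<subseteq> A" for G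
    unfolding infsum_Sigma_finite_ennreal[OF that(1), symmetric]
    using that(2) by (intro infsum_mono_neutral nonneg_summable_on_complete) auto
  then show "(\<Sum>\<^sub>\<infinity>x\<in>A. \<Sum>\<^sub>\<infinity>y\<in>B x. f (x, y)) \<le> infsum f (Sigma A B)"
    by (intro infsum_le_finite_sums nonneg_summable_on_complete) simp_all
qed

lemma infsum_swap_ennreal:
  fixes f :: "'a \<Rightarrow> 'b \<Rightarrow> ennreal"
  shows "(\<Sum>\<^sub>\<infinity>x\<in>A. \<Sum>\<^sub>\<infinity>y\<in>B. f x y) = (\<Sum>\<^sub>\<infinity>y\<in>B. \<Sum>\<^sub>\<infinity>x\<in>A. f x y)"
proof -
  have "(\<Sum>\<^sub>\<infinity>(x, y)\<in>A \<times> B. f x y) = (\<Sum>\<^sub>\<infinity>(y, x)\<in>B \<times> A. f x y)"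
    by (rule infsum_reindex_bij_witness[where i = prod.swap and j = prod.swap]) auto
  then show ?thesis by (simp add: infsum_Sigma_ennreal)
qed

text \<open>Multiplication by a constant, even by \<infinity>, commutes with suprema in
  \<open>ennreal\<close>.\<close>

lemma infsum_cmult_ennreal:
  fixes c :: ennreal
  shows "(\<Sum>\<^sub>\<infinity>x\<in>A. c * f x) = c * (\<Sum>\<^sub>\<infinity>x\<in>A. f x)"
  by (simp add: nonneg_infsum_complete SUP_mult_left_ennreal sum_distrib_left)

lemma infsum_delta_ennreal:
  fixes f :: "'a \<Rightarrow> ennreal"
  assumes "a \<in> A"
  shows "(\<Sum>\<^sub>\<infinity>x\<in>A. if x = a then f x else 0) = f a"
proof -
  have "(\<Sum>\<^sub>\<infinity>x\<in>A. if x = a then f x else 0) = (\<Sum>\<^sub>\<infinity>x\<in>{a}. f x)"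
    using assms by (intro infsum_cong_neutral) auto
  then show ?thesis by simp
qed

text \<open>Isolates one coordinate of \<open>s\<close>, so that the successor of one argument can
  be summed separately from those of the others.\<close>

lemma infsum_PiE_insert_ennreal:
  fixes F :: "('a \<Rightarrow> 'b) \<Rightarrow> ennreal"
  assumes "i \<notin> I"
  shows "(\<Sum>\<^sub>\<infinity>s \<in> insert i I \<rightarrow>\<^sub>E B. F s) = (\<Sum>\<^sub>\<infinity>s \<in> I \<rightarrow>\<^sub>E B. \<Sum>\<^sub>\<infinity>v\<in>B. F (s(i := v)))"
proof -
  have "(\<Sum>\<^sub>\<infinity>s \<in> insert i I \<rightarrow>\<^sub>E B. F s) = (\<Sum>\<^sub>\<infinity>(v, s) \<in> B \<times> (I \<rightarrow>\<^sub>E B). F (s(i := v)))"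
    using inj_combinator[OF assms, of "\<lambda>_. B"]
    by (simp add: PiE_insert_eq infsum_reindex o_def case_prod_unfold)
  also have "\<dots> = (\<Sum>\<^sub>\<infinity>s \<in> I \<rightarrow>\<^sub>E B. \<Sum>\<^sub>\<infinity>v\<in>B. F (s(i := v)))"
    unfolding infsum_Sigma_ennreal by (subst infsum_swap_ennreal) simp
  finally show ?thesis .
qed

section \<open>Closed terms, variables and substitution\<close>

lemma closed_terms_Fn:
  assumes "length ts = ar f" "\<And>i. i < ar f \<Longrightarrow> ts ! i \<in> closed_terms ar"
  shows "Fn f ts \<in> closed_terms ar"
  using assms unfolding closed_terms_def by (auto intro!: terms.Fn simp: in_set_conv_nth)

lemma set_var_list_subset: "t \<in> terms ar V \<Longrightarrow> set (var_list t) \<subseteq> V"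
  by (induction rule: terms.induct) auto

lemma subst_cong: "(\<And>v. v \<in> set (var_list t) \<Longrightarrow> \<sigma> v = \<tau> v) \<Longrightarrow> subst \<sigma> t = subst \<tau> t"
  by (induction t) auto

lemma subst_closed:
  "t \<in> terms ar V \<Longrightarrow> (\<And>v. v \<in> set (var_list t) \<Longrightarrow> \<sigma> v \<in> closed_terms ar) \<Longrightarrow>
    subst \<sigma> t \<in> closed_terms ar"
proof (induction rule: terms.induct)
  case (Fn ts f)
  then show ?case by (auto intro!: closed_terms_Fn) (metis nth_mem)
qed simp

text \<open>For the variable lists of the arguments of an affine term, this puts each variable into
  at most one argument.\<close>

lemma distinct_concat_nth_disjoint:
  assumes "distinct (concat xss)" "i < length xss" "j < length xss" "i \<noteq> j"
  shows "set (xss ! i) \<inter> set (xss ! j) = {}"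
  using assms
proof (induction xss arbitrary: i j)
  case (Cons xs xss)
  have "set xs \<inter> set (xss ! k) = {}" if "k < length xss" for k
    using Cons.prems(1) nth_mem[OF that] by auto
  with Cons show ?case by (cases i; cases j) auto
qed simp

section \<open>Observations and the trace map\<close>

text \<open>
  The probability of reading \<open>w\<close> and then, if \<open>e\<close> holds, terminating; if \<open>e\<close> fails, the
  continuation after \<open>w\<close> is unconstrained.
\<close>

primrec obs ::
  "('f \<Rightarrow> nat) \<Rightarrow> ('f, 'l) ds_rule set \<Rightarrow> bool \<Rightarrow> 'l list \<Rightarrow> ('f, var) trm \<Rightarrow> ennreal" where
  "obs ar R e [] t = (if e then op_model ar R t None else 1)"
| "obs ar R e (a # w) t =
     (\<Sum>\<^sub>\<infinity>u\<in>closed_terms ar. op_model ar R t (Some (a, u)) * obs ar R e w u)"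

lemma trace_map_Nil:
  assumes "x \<in> closed_terms ar"
  shows "trace_map ar R x [] = op_model ar R x None"
proof -
  have "{xs. set xs \<subseteq> closed_terms ar \<and> length xs = Suc 0 \<and> xs ! 0 = x} = {[x]}"
    using assms by (auto simp: length_Suc_conv)
  then show ?thesis by (simp add: trace_map_def)
qed

text \<open>Every path for \<open>a # w\<close> splits uniquely into its start \<open>x\<close> and
  a path for \<open>w\<close> from the second state \<open>u\<close>.\<close>

lemma trace_map_Cons:
  assumes "x \<in> closed_terms ar"
  shows "trace_map ar R x (a # w) =
    (\<Sum>\<^sub>\<infinity>u\<in>closed_terms ar. op_model ar R x (Some (a, u)) * trace_map ar R u w)"
proof -
  define P where "P u n = {xs. set xs \<subseteq> closed_terms ar \<and> length xs = Suc n \<and> xs ! 0 = u}" for u n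
  define G where "G xs w = (\<Prod>i<length w. op_model ar R (xs ! i) (Some (w ! i, xs ! Suc i)))
        * op_model ar R (xs ! length w) None" for xs w
  have tr: "trace_map ar R u w = (\<Sum>\<^sub>\<infinity>xs\<in>P u (length w). G xs w)" for u w
    by (simp add: trace_map_def P_def G_def)
  have G: "G (x # ys) (a # w) = op_model ar R x (Some (a, ys ! 0)) * G ys w" for ys
    by (simp add: G_def prod.lessThan_Suc_shift mult.assoc del: prod.lessThan_Suc)
  let ?S = "Sigma (closed_terms ar) (\<lambda>u. P u (length w))"
  have P: "P x (length (a # w)) = (\<lambda>(u, ys). x # ys) ` ?S"
  proof (intro equalityI subsetI)
    fix xs assume "xs \<in> P x (length (a # w))"
    then obtain y ys where "xs = x # y # ys" "y # ys \<in> P y (length w)" "y \<in> closed_terms ar"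
      by (auto simp: P_def length_Suc_conv)
    then show "xs \<in> (\<lambda>(u, ys). x # ys) ` ?S"
      by (intro image_eqI[of _ _ "(y, y # ys)"]) auto
  qed (use assms in \<open>auto simp: P_def\<close>)
  have "inj_on (\<lambda>(u, ys). x # ys) ?S" by (auto simp: inj_on_def P_def)
  then have "trace_map ar R x (a # w) = (\<Sum>\<^sub>\<infinity>(u, ys)\<in>?S. G (x # ys) (a # w))"
    unfolding tr P by (simp add: infsum_reindex o_def case_prod_unfold)
  also have "\<dots> = (\<Sum>\<^sub>\<infinity>u\<in>closed_terms ar. \<Sum>\<^sub>\<infinity>ys\<in>P u (length w). G (x # ys) (a # w))"
    by (simp only: infsum_Sigma_ennreal prod.case)
  also have "\<dots> = (\<Sum>\<^sub>\<infinity>u\<in>closed_terms ar. op_model ar R x (Some (a, u)) * trace_map ar R u w)"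
    unfolding tr infsum_cmult_ennreal[symmetric]
    by (intro infsum_cong) (simp add: G P_def)
  finally show ?thesis .
qed

lemma obs_True_eq_trace_map:
  "t \<in> closed_terms ar \<Longrightarrow> obs ar R True w t = trace_map ar R t w"
proof (induction w arbitrary: t)
  case (Cons a w)
  then show ?case by (auto simp: trace_map_Cons intro!: infsum_cong)
qed (simp add: trace_map_Nil)

text \<open>Almost sure termination enters at the empty prefix: its probability 1 is the total mass
  of all traces. Longer prefixes follow by exchanging the sum over successors with the one over
  \<open>v\<close>.\<close>

lemma obs_False_eq_infsum_trace_map:
  assumes "almost_surely_terminating ar R" "t \<in> closed_terms ar"
  shows "obs ar R False w t = (\<Sum>\<^sub>\<infinity>v. trace_map ar R t (w @ v))"
  using assms(2)
proof (induction w arbitrary: t)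
  case Nil
  then show ?case
    using assms(1) by (simp add: almost_surely_terminating_def is_distribution_def)
next
  case (Cons a w)
  have "obs ar R False (a # w) t =
      (\<Sum>\<^sub>\<infinity>u\<in>closed_terms ar. \<Sum>\<^sub>\<infinity>v. op_model ar R t (Some (a, u)) * trace_map ar R u (w @ v))"
    by (auto simp: Cons.IH infsum_cmult_ennreal intro!: infsum_cong)
  also have "\<dots> = (\<Sum>\<^sub>\<infinity>v. trace_map ar R t ((a # w) @ v))"
    by (subst infsum_swap_ennreal) (simp add: trace_map_Cons Cons.prems)
  finally show ?case .
qed

lemma trace_map_determines_obs:
  assumes "almost_surely_terminating ar R" "(t, s) \<in> trace_equiv ar R"
  shows "obs ar R e w t = obs ar R e w s"
  using assms by (cases e)
    (auto simp: trace_equiv_def obs_True_eq_trace_map obs_False_eq_infsum_trace_map)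

section \<open>Unfolding the first step of an observation\<close>

text \<open>The probability of passing the observation \<open>(w, e)\<close> given that the first step has outcome \<open>z\<close>;
  meaningful unless \<open>(w, e) = ([], False)\<close>, which requires no step.\<close>

definition cont ::
  "('f \<Rightarrow> nat) \<Rightarrow> ('f, 'l) ds_rule set \<Rightarrow> bool \<Rightarrow> 'l list \<Rightarrow>
   ('l \<times> ('f, var) trm) option \<Rightarrow> ennreal" where
  "cont ar R e w z =
     (case (w, z) of
        ([], None) \<Rightarrow> 1
      | (b # w', Some (a, u)) \<Rightarrow> if a = b then obs ar R e w' u else 0
      | _ \<Rightarrow> 0)"

lemma obs_eq_infsum_outcomes:
  assumes "e \<or> w \<noteq> []"
  shows "obs ar R e w t = (\<Sum>\<^sub>\<infinity>z\<in>outcomes ar. op_model ar R t z * cont ar R e w z)"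
proof (cases w)
  case Nil
  have "(\<Sum>\<^sub>\<infinity>z\<in>outcomes ar. op_model ar R t z * cont ar R e w z) =
      (\<Sum>\<^sub>\<infinity>z\<in>{None}. op_model ar R t z)"
    by (rule infsum_cong_neutral) (auto simp: outcomes_def cont_def Nil)
  then show ?thesis using assms Nil by simp
next
  case (Cons b w')
  have "(\<Sum>\<^sub>\<infinity>z\<in>outcomes ar. op_model ar R t z * cont ar R e w z) =
      (\<Sum>\<^sub>\<infinity>z\<in>(\<lambda>u. Some (b, u)) ` closed_terms ar. op_model ar R t z * cont ar R e w z)"
    by (rule infsum_cong_neutral) (auto simp: outcomes_def cont_def Cons split: if_splits)
  also have "\<dots> = obs ar R e w t"
    by (subst infsum_reindex) (auto simp: inj_on_def cont_def Cons o_def)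
  finally show ?thesis ..
qed

text \<open>A rule together with a choice \<open>s\<close> of successors yields exactly one outcome.
  Once the sum over outcomes is moved innermost, it collapses to the continuation from that
  outcome.\<close>

lemma obs_Fn:
  assumes rules: "\<forall>\<rho>\<in>R. de_simone_rule ar \<rho>"
    and len: "length us = ar f" and closed: "\<And>i. i < ar f \<Longrightarrow> us ! i \<in> closed_terms ar"
    and ew: "e \<or> w \<noteq> []"
  shows "obs ar R e w (Fn f us) =
    (\<Sum>\<^sub>\<infinity>\<rho> \<in> {\<rho> \<in> R. head \<rho> = f}. \<Sum>\<^sub>\<infinity>s \<in> dom (acts \<rho>) \<rightarrow>\<^sub>E closed_terms ar.
       weight \<rho> * (\<Prod>i\<in>dom (acts \<rho>). op_model ar R (us ! i) (Some (the (acts \<rho> i), s i)))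
                * (\<Prod>j\<in>stops \<rho>. op_model ar R (us ! j) None)
                * cont ar R e w (map_option (\<lambda>(a, t). (a, subst (rule_subst us s) t)) (concl \<rho>)))"
proof -
  define C where "C \<rho> s = map_option (\<lambda>(a, t). (a, subst (rule_subst us s) t)) (concl \<rho>)"
    for \<rho> :: "('a, 'b) ds_rule" and s
  define W where "W \<rho> s =
      weight \<rho> * (\<Prod>i\<in>dom (acts \<rho>). op_model ar R (us ! i) (Some (the (acts \<rho> i), s i)))
               * (\<Prod>j\<in>stops \<rho>. op_model ar R (us ! j) None)" for \<rho> :: "('a, 'b) ds_rule" and s
  let ?R = "{\<rho> \<in> R. head \<rho> = f}" and ?S = "\<lambda>\<rho>. dom (acts \<rho>) \<rightarrow>\<^sub>E closed_terms ar"
  \<comment> \<open>The target of a rule instance is closed, so its outcome is among the indices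
    \<open>z\<close> and the delta sum below picks it up.\<close>
  have C: "C \<rho> s \<in> outcomes ar" if "\<rho> \<in> ?R" "s \<in> ?S \<rho>" for \<rho> s
  proof (cases "concl \<rho>")
    case None
    then show ?thesis by (simp add: C_def outcomes_def)
  next
    case (Some p)
    obtain a t where p: "p = (a, t)" by (cases p)
    have \<rho>: "de_simone_rule ar \<rho>" "head \<rho> = f" using rules that(1) by auto
    then have t: "t \<in> terms ar (VY ` dom (acts \<rho>) \<union> VX ` ({..<ar f} - (dom (acts \<rho>) \<union> stops \<rho>)))"
      (is "_ \<in> terms ar ?V")
      using Some p by (simp add: de_simone_rule_def)
    have rs: "rule_subst us s v \<in> closed_terms ar" if "v \<in> ?V" for v
      using that closed \<open>s \<in> ?S \<rho>\<close> by (auto dest: PiE_mem)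
    have "subst (rule_subst us s) t \<in> closed_terms ar"
      by (intro subst_closed[OF t] rs) (rule set_var_list_subset[OF t, THEN subsetD])
    then show ?thesis by (simp add: C_def outcomes_def Some p)
  qed
  have "obs ar R e w (Fn f us) =
      (\<Sum>\<^sub>\<infinity>z\<in>outcomes ar. \<Sum>\<^sub>\<infinity>\<rho>\<in>?R. \<Sum>\<^sub>\<infinity>s\<in>?S \<rho>.
         if z = C \<rho> s then W \<rho> s * cont ar R e w z else 0)"
    unfolding obs_eq_infsum_outcomes[OF ew]
  proof (intro infsum_cong)
    fix z
    show "op_model ar R (Fn f us) z * cont ar R e w z =
        (\<Sum>\<^sub>\<infinity>\<rho>\<in>?R. \<Sum>\<^sub>\<infinity>s\<in>?S \<rho>. if z = C \<rho> s then W \<rho> s * cont ar R e w z else 0)"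
      unfolding op_model_Fn[OF rules len] rule_model_def C_def[symmetric] W_def[symmetric]
      unfolding mult.commute[of _ "cont ar R e w z"] infsum_cmult_ennreal[symmetric]
      by (intro infsum_cong) simp
  qed
  also have "\<dots> = (\<Sum>\<^sub>\<infinity>\<rho>\<in>?R. \<Sum>\<^sub>\<infinity>s\<in>?S \<rho>. \<Sum>\<^sub>\<infinity>z\<in>outcomes ar.
         if z = C \<rho> s then W \<rho> s * cont ar R e w z else 0)"
    by (simp only: infsum_swap_ennreal[where A = "outcomes ar"])
  also have "\<dots> = (\<Sum>\<^sub>\<infinity>\<rho>\<in>?R. \<Sum>\<^sub>\<infinity>s\<in>?S \<rho>. W \<rho> s * cont ar R e w (C \<rho> s))"
    using C by (intro infsum_cong infsum_delta_ennreal)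
  finally show ?thesis by (simp only: W_def C_def)
qed

section \<open>Functionals that are linear in the observations\<close>

text \<open>
  The observations of at most \<open>N\<close> steps, termination counting as a step. Without a bound that the
  rules do not increase, the induction over observations would not be well-founded: the arguments
  of the target of a rule are subjected to new observations.
\<close>

definition tests :: "nat \<Rightarrow> ('l list \<times> bool) set" where
  "tests N = {(w, e). length w + of_bool e \<le> N}"

text \<open>Linearity, rather than mere dependence on the observations, is what survives a
  transition of \<open>u\<close>: a weighted sum over successors can be exchanged with the sum over
  \<open>q\<close>.\<close>

definition obs_linear ::
  "('f \<Rightarrow> nat) \<Rightarrow> ('f, 'l) ds_rule set \<Rightarrow> nat \<Rightarrow> (('f, var) trm \<Rightarrow> ennreal) \<Rightarrow> bool" where
  "obs_linear ar R N \<Phi> \<longleftrightarrow>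
     (\<exists>c. \<forall>u\<in>closed_terms ar. \<Phi> u = (\<Sum>\<^sub>\<infinity>q\<in>tests N. c q * obs ar R (snd q) (fst q) u))"

lemma obs_linear_cong:
  assumes "obs_linear ar R N \<Phi>" "\<And>u. u \<in> closed_terms ar \<Longrightarrow> \<Psi> u = \<Phi> u"
  shows "obs_linear ar R N \<Psi>"
  using assms by (simp add: obs_linear_def)

lemma obs_linear_obs:
  assumes "(w, e) \<in> tests N"
  shows "obs_linear ar R N (obs ar R e w)"
  unfolding obs_linear_def
proof (intro exI[of _ "\<lambda>q. if q = (w, e) then 1 else 0"] ballI)
  fix u
  have "(\<Sum>\<^sub>\<infinity>q\<in>tests N. (if q = (w, e) then 1 else 0) * obs ar R (snd q) (fst q) u) =
      (\<Sum>\<^sub>\<infinity>q\<in>tests N. if q = (w, e) then obs ar R (snd q) (fst q) u else 0)"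
    by (intro infsum_cong) simp
  also have "\<dots> = obs ar R e w u"
    using infsum_delta_ennreal[OF assms, of "\<lambda>q. obs ar R (snd q) (fst q) u"] by simp
  finally show "obs ar R e w u =
      (\<Sum>\<^sub>\<infinity>q\<in>tests N. (if q = (w, e) then 1 else 0) * obs ar R (snd q) (fst q) u)" ..
qed

text \<open>The coefficients of the summands add up; every sum exists in \<open>ennreal\<close>, so
  \<open>K\<close> may be any set.\<close>

lemma obs_linear_infsum:
  assumes "\<And>k. k \<in> K \<Longrightarrow> obs_linear ar R N (\<Phi> k)"
  shows "obs_linear ar R N (\<lambda>u. \<Sum>\<^sub>\<infinity>k\<in>K. \<Phi> k u)"
proof -
  obtain c where c: "\<And>k u. k \<in> K \<Longrightarrow> u \<in> closed_terms ar \<Longrightarrow>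
      \<Phi> k u = (\<Sum>\<^sub>\<infinity>q\<in>tests N. c k q * obs ar R (snd q) (fst q) u)"
    using bchoice[of K "\<lambda>k c. \<forall>u\<in>closed_terms ar. \<Phi> k u =
        (\<Sum>\<^sub>\<infinity>q\<in>tests N. c q * obs ar R (snd q) (fst q) u)"] assms
    unfolding obs_linear_def by blast
  have "(\<Sum>\<^sub>\<infinity>k\<in>K. \<Phi> k u) =
      (\<Sum>\<^sub>\<infinity>q\<in>tests N. (\<Sum>\<^sub>\<infinity>k\<in>K. c k q) * obs ar R (snd q) (fst q) u)"
    if "u \<in> closed_terms ar" for u
  proof -
    have "(\<Sum>\<^sub>\<infinity>k\<in>K. \<Phi> k u) =
        (\<Sum>\<^sub>\<infinity>k\<in>K. \<Sum>\<^sub>\<infinity>q\<in>tests N. c k q * obs ar R (snd q) (fst q) u)"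
      using that by (intro infsum_cong c)
    also have "\<dots> = (\<Sum>\<^sub>\<infinity>q\<in>tests N. \<Sum>\<^sub>\<infinity>k\<in>K. c k q * obs ar R (snd q) (fst q) u)"
      by (rule infsum_swap_ennreal)
    finally show ?thesis
      by (simp only: mult.commute[of _ "obs ar R _ _ _"] infsum_cmult_ennreal)
  qed
  then show ?thesis unfolding obs_linear_def by (intro exI ballI)
qed

lemma obs_linear_cmult:
  assumes "obs_linear ar R N \<Phi>"
  shows "obs_linear ar R N (\<lambda>u. k * \<Phi> u)"
proof -
  obtain c where "\<And>u. u \<in> closed_terms ar \<Longrightarrow>
      \<Phi> u = (\<Sum>\<^sub>\<infinity>q\<in>tests N. c q * obs ar R (snd q) (fst q) u)"
    using assms unfolding obs_linear_def by blast
  then have "k * \<Phi> u = (\<Sum>\<^sub>\<infinity>q\<in>tests N. (k * c q) * obs ar R (snd q) (fst q) u)"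
    if "u \<in> closed_terms ar" for u
    using that by (simp add: mult.assoc infsum_cmult_ennreal)
  then show ?thesis unfolding obs_linear_def by (intro exI ballI)
qed

text \<open>The observation \<open>([], False)\<close> has value 1 at every term, so constants are
  multiples of it.\<close>

lemma obs_linear_const: "obs_linear ar R N (\<lambda>_. k)"
  using obs_linear_cmult[OF obs_linear_obs[of "[]" False N ar R], of k]
  by (simp add: tests_def)

text \<open>Expanding \<open>\<Phi>\<close> reduces the claim to single observations of
  \<open>\<kappa> u\<close>.\<close>

lemma obs_linear_compose:
  assumes "obs_linear ar R N \<Phi>"
    and "\<And>u. u \<in> closed_terms ar \<Longrightarrow> \<kappa> u \<in> closed_terms ar"
    and "\<And>w e. (w, e) \<in> tests N \<Longrightarrow> obs_linear ar R M (\<lambda>u. obs ar R e w (\<kappa> u))"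
  shows "obs_linear ar R M (\<lambda>u. \<Phi> (\<kappa> u))"
proof -
  obtain c where c: "\<And>u. u \<in> closed_terms ar \<Longrightarrow>
      \<Phi> u = (\<Sum>\<^sub>\<infinity>q\<in>tests N. c q * obs ar R (snd q) (fst q) u)"
    using assms(1) unfolding obs_linear_def by blast
  have "obs_linear ar R M (\<lambda>u. \<Sum>\<^sub>\<infinity>q\<in>tests N. c q * obs ar R (snd q) (fst q) (\<kappa> u))"
    using assms(3) by (intro obs_linear_infsum obs_linear_cmult) auto
  then show ?thesis
    by (rule obs_linear_cong) (simp add: c assms(2))
qed

lemma obs_linear_mono:
  assumes "obs_linear ar R N \<Phi>" "N \<le> M"
  shows "obs_linear ar R M \<Phi>"
  using assms(1) by (rule obs_linear_compose[where \<kappa> = "\<lambda>u. u"])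
    (use assms(2) in \<open>auto intro!: obs_linear_obs simp: tests_def\<close>)

text \<open>The transition is absorbed into the observations: \<open>(w, e)\<close> becomes
  \<open>(a # w, e)\<close>, which raises the bound by one.\<close>

lemma obs_linear_step:
  assumes "obs_linear ar R N \<Phi>"
  shows "obs_linear ar R (Suc N)
    (\<lambda>u. \<Sum>\<^sub>\<infinity>v\<in>closed_terms ar. op_model ar R u (Some (a, v)) * \<Phi> v)"
proof -
  obtain c where c: "\<And>u. u \<in> closed_terms ar \<Longrightarrow>
      \<Phi> u = (\<Sum>\<^sub>\<infinity>q\<in>tests N. c q * obs ar R (snd q) (fst q) u)"
    using assms(1) unfolding obs_linear_def by blast
  have "(\<Sum>\<^sub>\<infinity>v\<in>closed_terms ar. op_model ar R u (Some (a, v)) * \<Phi> v) =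
      (\<Sum>\<^sub>\<infinity>q\<in>tests N. c q * obs ar R (snd q) (a # fst q) u)" for u
  proof -
    have "(\<Sum>\<^sub>\<infinity>v\<in>closed_terms ar. op_model ar R u (Some (a, v)) * \<Phi> v) =
        (\<Sum>\<^sub>\<infinity>v\<in>closed_terms ar. \<Sum>\<^sub>\<infinity>q\<in>tests N.
           c q * (op_model ar R u (Some (a, v)) * obs ar R (snd q) (fst q) v))"
      by (intro infsum_cong)
         (simp add: c mult.left_commute infsum_cmult_ennreal[symmetric])
    also have "\<dots> = (\<Sum>\<^sub>\<infinity>q\<in>tests N. c q * obs ar R (snd q) (a # fst q) u)"
      by (subst infsum_swap_ennreal) (simp add: infsum_cmult_ennreal)
    finally show ?thesis .
  qed
  moreover have "obs_linear ar R (Suc N) (\<lambda>u. \<Sum>\<^sub>\<infinity>q\<in>tests N. c q * obs ar R (snd q) (a # fst q) u)"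
    by (intro obs_linear_infsum obs_linear_cmult obs_linear_obs) (auto simp: tests_def)
  ultimately show ?thesis by simp
qed

section \<open>Linearity of operations and affine terms in one argument\<close>

definition obs_linear_ops :: "('f \<Rightarrow> nat) \<Rightarrow> ('f, 'l) ds_rule set \<Rightarrow> nat \<Rightarrow> bool" where
  "obs_linear_ops ar R N \<longleftrightarrow>
     (\<forall>f us i w e. (w, e) \<in> tests N \<longrightarrow> length us = ar f \<longrightarrow> i < ar f \<longrightarrow>
        (\<forall>j<ar f. j \<noteq> i \<longrightarrow> us ! j \<in> closed_terms ar) \<longrightarrow>
        obs_linear ar R N (\<lambda>u. obs ar R e w (Fn f (us[i := u]))))"

text \<open>By affineness \<open>x\<close> lies in at most one argument at each level, so the
  induction follows a single branch. The sibling arguments are fixed closed terms, and the linearity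
  of the operations along the branch is composed.\<close>

lemma obs_linear_subst:
  assumes ops: "obs_linear_ops ar R N"
    and t: "t \<in> terms ar V" "affine_term t"
    and \<theta>: "\<And>v. v \<in> set (var_list t) \<Longrightarrow> v \<noteq> x \<Longrightarrow> \<theta> v \<in> closed_terms ar"
    and we: "(w, e) \<in> tests N"
  shows "obs_linear ar R N (\<lambda>u. obs ar R e w (subst (\<theta>(x := u)) t))"
  using t \<theta> we
proof (induction arbitrary: w e rule: terms.induct)
  case (Var v)
  then show ?case
    by (cases "v = x") (auto intro: obs_linear_obs obs_linear_const)
next
  case (Fn ts f)
  show ?case
  proof (cases "x \<in> set (var_list (Fn f ts))")
    case False
    then have "subst (\<theta>(x := u)) (Fn f ts) = subst \<theta> (Fn f ts)" for u
      by (intro subst_cong) auto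
    then show ?thesis by (simp only: obs_linear_const)
  next
    case True
    then obtain i where i: "i < ar f" "x \<in> set (var_list (ts ! i))"
      using Fn.hyps(1) by (auto simp: in_set_conv_nth[of _ ts])
    have sub: "set (var_list (ts ! j)) \<subseteq> set (var_list (Fn f ts))" if "j < ar f" for j
      using that Fn.hyps(1) by (auto intro!: bexI[of _ "ts ! j"])
    have \<theta>_sub: "\<theta> v \<in> closed_terms ar"
      if "j < ar f" "v \<in> set (var_list (ts ! j))" "v \<noteq> x" for j v
      by (rule Fn.prems(2)[OF subsetD[OF sub[OF that(1)] that(2)] that(3)])
    have nx: "x \<notin> set (var_list (ts ! j))" if "j < ar f" "j \<noteq> i" for j
      using distinct_concat_nth_disjoint[of "map var_list ts" i j] Fn.prems(1) Fn.hyps(1) i that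
      by (auto simp: affine_term_def)
    \<comment> \<open>\<open>\<theta> x\<close> may fail to be closed; it affects only entry
      \<open>i\<close> of this list, which is overwritten below.\<close>
    let ?us = "map (subst \<theta>) ts"
    have us: "?us ! j \<in> closed_terms ar" if "j < ar f" "j \<noteq> i" for j
    proof -
      have "ts ! j \<in> terms ar V" using Fn.hyps that by simp
      then have "subst \<theta> (ts ! j) \<in> closed_terms ar"
        by (rule subst_closed) (use nx[OF that] in \<open>auto intro: \<theta>_sub[OF that(1)]\<close>)
      then show ?thesis using that Fn.hyps(1) by simp
    qed
    have ti: "ts ! i \<in> terms ar V" "ts ! i \<in> set ts" using Fn.hyps i by simp_all
    have "distinct (var_list (ts ! i))"
      using Fn.prems(1) ti(2) by (auto simp: affine_term_def distinct_concat_iff)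
    then have aff: "affine_term (ts ! i)" by (simp add: affine_term_def)
    have eq: "subst (\<theta>(x := u)) (Fn f ts) = Fn f (?us[i := subst (\<theta>(x := u)) (ts ! i)])" for u
    proof -
      have "map (subst (\<theta>(x := u))) ts = ?us[i := subst (\<theta>(x := u)) (ts ! i)]"
      proof (rule nth_equalityI)
        fix j assume "j < length (map (subst (\<theta>(x := u))) ts)"
        then show "map (subst (\<theta>(x := u))) ts ! j = ?us[i := subst (\<theta>(x := u)) (ts ! i)] ! j"
          using nx[of j] Fn.hyps(1) by (cases "j = i") (auto intro!: subst_cong)
      qed simp
      then show ?thesis by simp
    qed
    have "obs_linear ar R N (\<lambda>u. obs ar R e w (Fn f (?us[i := subst (\<theta>(x := u)) (ts ! i)])))"
    proof (rule obs_linear_compose[where \<Phi> = "\<lambda>u. obs ar R e w (Fn f (?us[i := u]))"])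
      show "obs_linear ar R N (\<lambda>u. obs ar R e w (Fn f (?us[i := u])))"
        using us i Fn.hyps(1) Fn.prems(3)
        by (intro ops[unfolded obs_linear_ops_def, rule_format]) auto
      show "subst (\<theta>(x := u)) (ts ! i) \<in> closed_terms ar" if "u \<in> closed_terms ar" for u
        using that \<theta>_sub[OF i(1)] by (intro subst_closed[OF ti(1)]) auto
      show "obs_linear ar R N (\<lambda>u. obs ar R d v (subst (\<theta>(x := u)) (ts ! i)))"
        if "(v, d) \<in> tests N" for v d
        by (rule Fn.IH[OF ti(2) aff \<theta>_sub[OF i(1)] that])
    qed
    then show ?thesis by (simp only: eq)
  qed
qed

text \<open>Matching the first label uses up one step, so the rest \<open>w'\<close> is an
  observation of the target within the bound \<open>N\<close>. Every other combination of conclusion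
  and \<open>w\<close> gives the constant 0 or 1.\<close>

lemma obs_linear_cont:
  assumes ops: "obs_linear_ops ar R N"
    and p: "\<And>a t. p = Some (a, t) \<Longrightarrow> t \<in> terms ar V \<and> affine_term t"
    and \<theta>: "\<And>v. v \<in> V \<Longrightarrow> v \<noteq> x \<Longrightarrow> \<theta> v \<in> closed_terms ar"
    and we: "(w, e) \<in> tests (Suc N)"
  shows "obs_linear ar R N
    (\<lambda>u. cont ar R e w (map_option (\<lambda>(a, t). (a, subst (\<theta>(x := u)) t)) p))"
proof (cases "\<exists>a t w'. p = Some (a, t) \<and> w = a # w'")
  case True
  then obtain a t w' where eq: "p = Some (a, t)" "w = a # w'" by blast
  then have t: "t \<in> terms ar V" "affine_term t" using p by blast+
  have "obs_linear ar R N (\<lambda>u. obs ar R e w' (subst (\<theta>(x := u)) t))"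
    using we eq set_var_list_subset[OF t(1)]
    by (intro obs_linear_subst[OF ops t] \<theta>) (auto simp: tests_def)
  then show ?thesis by (simp add: cont_def eq)
next
  case False
  have "(\<lambda>u. cont ar R e w (map_option (\<lambda>(a, t). (a, subst (\<theta>(x := u)) t)) p)) =
      (\<lambda>_. if p = None \<and> w = [] then 1 else 0)"
    using False by (auto simp: cont_def fun_eq_iff split: list.splits option.splits)
  then show ?thesis by (simp only: obs_linear_const)
qed

text \<open>Induction on the bound: a rule uses one step of the observation and at most one step of
  \<open>u\<close>. The hypothesis for \<open>N\<close> covers the target, and the total spent on
  \<open>u\<close> stays within \<open>Suc N\<close>.\<close>

lemma obs_linear_ops:
  assumes rules: "\<forall>\<rho>\<in>R. de_simone_rule ar \<rho>"
  shows "obs_linear_ops ar R N"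
proof (induction N)
  case 0
  \<comment> \<open>\<open>tests 0\<close> contains only \<open>([], False)\<close>, which is
    constantly 1.\<close>
  have "obs_linear ar R 0 (\<lambda>u. obs ar R e w (Fn f (us[i := u])))" if "(w, e) \<in> tests 0"
    for w e f us i
    using that obs_linear_const[of ar R 0 1] by (simp add: tests_def)
  then show ?case by (auto simp: obs_linear_ops_def)
next
  case (Suc N)
  have "obs_linear ar R (Suc N) (\<lambda>u. obs ar R e w (Fn f (us[i := u])))"
    if we: "(w, e) \<in> tests (Suc N)" and len: "length us = ar f" and i: "i < ar f"
      and us: "\<And>j. j < ar f \<Longrightarrow> j \<noteq> i \<Longrightarrow> us ! j \<in> closed_terms ar"
    for w e f us i
  proof (cases "e \<or> w \<noteq> []")
    case False
    then show ?thesis using obs_linear_const[of ar R "Suc N" 1] by simp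
  next
    case ew: True
    \<comment> \<open>\<open>?G\<close> is the summand from \<open>obs_Fn\<close> for the arguments
      \<open>us[i := u]\<close>. Its factors come from the transition premises (\<open>?A\<close>),
      the termination premises (\<open>?T\<close>) and the continuation (\<open>?C\<close>).\<close>
    let ?C = "\<lambda>\<rho> \<sigma>. cont ar R e w (map_option (\<lambda>(a, t). (a, subst \<sigma> t)) (concl \<rho>))"
    let ?A = "\<lambda>\<rho> us s I. \<Prod>k\<in>I. op_model ar R (us ! k) (Some (the (acts \<rho> k), s k))"
    let ?T = "\<lambda>us I. \<Prod>k\<in>I. op_model ar R (us ! k) None"
    let ?G = "\<lambda>\<rho> u s. weight \<rho> * ?A \<rho> (us[i := u]) s (dom (acts \<rho>)) * ?T (us[i := u]) (stops \<rho>)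
                * ?C \<rho> (rule_subst (us[i := u]) s)"
    have rule_linear:
      "obs_linear ar R (Suc N) (\<lambda>u. \<Sum>\<^sub>\<infinity>s \<in> dom (acts \<rho>) \<rightarrow>\<^sub>E closed_terms ar. ?G \<rho> u s)"
      if \<rho>: "\<rho> \<in> R" "head \<rho> = f" for \<rho>
    proof -
      define D where "D = dom (acts \<rho>)"
      define V where "V = VY ` D \<union> VX ` ({..<ar f} - (D \<union> stops \<rho>))"
      have "de_simone_rule ar \<rho>" using rules \<rho> by blast
      then have ds: "D \<subseteq> {..<ar f}" "stops \<rho> \<subseteq> {..<ar f}" "D \<inter> stops \<rho> = {}"
        and concl: "\<And>a t. concl \<rho> = Some (a, t) \<Longrightarrow> t \<in> terms ar V \<and> affine_term t"
        using \<rho> unfolding de_simone_rule_def D_def V_def by simp_all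
      have fin: "finite D" "finite (stops \<rho>)" using ds finite_subset by blast+
      \<comment> \<open>Only variables in \<open>V\<close> can occur in the target, so
        \<open>us ! i\<close> may replace \<open>u\<close> in the substitution when position
        \<open>i\<close> carries a premise.\<close>
      have C_cong: "?C \<rho> \<sigma> = ?C \<rho> \<tau>" if "\<And>v. v \<in> V \<Longrightarrow> \<sigma> v = \<tau> v" for \<sigma> \<tau>
      proof -
        have "subst \<sigma> t = subst \<tau> t" if "concl \<rho> = Some (a, t)" for a t
          using concl[OF that] set_var_list_subset \<open>\<And>v. v \<in> V \<Longrightarrow> \<sigma> v = \<tau> v\<close>
          by (intro subst_cong) blast
        then show ?thesis by (cases "concl \<rho>") auto
      qed
      have upd: "us[i := u] ! k = us ! k" if "k \<in> I" "i \<notin> I" for k I u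
        using that by (metis nth_list_update_neq)
      have A_upd: "?A \<rho> (us[i := u]) s I = ?A \<rho> us s I" if "i \<notin> I" for I s u
        by (rule prod.cong) (simp_all add: upd[OF _ that])
      have T_upd: "?T (us[i := u]) I = ?T us I" if "i \<notin> I" for I u
        by (rule prod.cong) (simp_all add: upd[OF _ that])
      \<comment> \<open>Position \<open>i\<close> has a transition premise, a termination premise,
        or no premise.\<close>
      consider "i \<in> D" | "i \<in> stops \<rho>" "i \<notin> D" | "i \<notin> D" "i \<notin> stops \<rho>" by blast
      then have "obs_linear ar R (Suc N) (\<lambda>u. \<Sum>\<^sub>\<infinity>s \<in> D \<rightarrow>\<^sub>E closed_terms ar. ?G \<rho> u s)"
      proof cases
        case 1
        define E where "E = D - {i}"
        have D: "D = insert i E" "i \<notin> E" "finite E" using 1 fin by (auto simp: E_def)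
        \<comment> \<open>The step of \<open>u\<close> to \<open>v\<close> is split off from the
          steps of the other arguments. As \<open>VX i\<close> is barred from the target,
          \<open>u\<close> survives only through \<open>v\<close>, the value of \<open>VY i\<close>.
          The target is linear within bound \<open>N\<close>, and the step raises this to
          \<open>Suc N\<close>.\<close>
        have "obs_linear ar R (Suc N) (\<lambda>u. \<Sum>\<^sub>\<infinity>s \<in> E \<rightarrow>\<^sub>E closed_terms ar.
            weight \<rho> * ?A \<rho> us s E * ?T us (stops \<rho>) *
            (\<Sum>\<^sub>\<infinity>v\<in>closed_terms ar. op_model ar R u (Some (the (acts \<rho> i), v)) *
               ?C \<rho> ((rule_subst us s)(VY i := v))))"
        proof (rule obs_linear_infsum, rule obs_linear_cmult, rule obs_linear_step,
            rule obs_linear_cont[OF Suc.IH concl _ we])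
          \<comment> \<open>Here \<open>s i\<close> is \<open>undefined\<close>, as \<open>i\<close>
            is not in \<open>E\<close>; the update at \<open>VY i\<close> hides this value.\<close>
          fix s v assume s: "s \<in> E \<rightarrow>\<^sub>E closed_terms ar" and v: "v \<in> V" "v \<noteq> VY i"
          then show "rule_subst us s v \<in> closed_terms ar"
            using us 1 PiE_mem[OF s] unfolding V_def D(1) by auto
        qed
        moreover have "(\<Sum>\<^sub>\<infinity>s \<in> D \<rightarrow>\<^sub>E closed_terms ar. ?G \<rho> u s) =
            (\<Sum>\<^sub>\<infinity>s \<in> E \<rightarrow>\<^sub>E closed_terms ar.
            weight \<rho> * ?A \<rho> us s E * ?T us (stops \<rho>) *
            (\<Sum>\<^sub>\<infinity>v\<in>closed_terms ar. op_model ar R u (Some (the (acts \<rho> i), v)) *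
               ?C \<rho> ((rule_subst us s)(VY i := v))))" for u
        proof -
          have "?G \<rho> u (s(i := v)) = weight \<rho> * ?A \<rho> us s E * ?T us (stops \<rho>) *
              (op_model ar R u (Some (the (acts \<rho> i), v)) * ?C \<rho> ((rule_subst us s)(VY i := v)))"
            for s v
          proof -
            have "?A \<rho> (us[i := u]) (s(i := v)) D =
                op_model ar R u (Some (the (acts \<rho> i), v)) * ?A \<rho> (us[i := u]) (s(i := v)) E"
              using D i len by simp
            also have "?A \<rho> (us[i := u]) (s(i := v)) E = ?A \<rho> us s E"
              by (rule prod.cong) (use D(2) in \<open>auto simp: upd[OF _ D(2)]\<close>)
            finally have A: "?A \<rho> (us[i := u]) (s(i := v)) D =
                op_model ar R u (Some (the (acts \<rho> i), v)) * ?A \<rho> us s E" .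
            have T: "?T (us[i := u]) (stops \<rho>) = ?T us (stops \<rho>)"
              using 1 ds by (intro T_upd) auto
            have C: "?C \<rho> (rule_subst (us[i := u]) (s(i := v))) =
                ?C \<rho> ((rule_subst us s)(VY i := v))"
              using 1 i len by (intro C_cong) (auto simp: V_def nth_list_update split: if_splits)
            show ?thesis
              unfolding D_def[symmetric] A T C by (simp only: ac_simps)
          qed
          then show ?thesis
            unfolding D(1) infsum_PiE_insert_ennreal[OF D(2)] by (simp only: infsum_cmult_ennreal)
        qed
        ultimately show ?thesis by (simp only:)
      next
        case 2
        define E where "E = stops \<rho> - {i}"
        have E: "stops \<rho> = insert i E" "i \<notin> E" "finite E" using 2 fin by (auto simp: E_def)
        \<comment> \<open>Neither \<open>VX i\<close> nor \<open>VY i\<close> occurs in the target: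
          \<open>u\<close> contributes only its termination, the observation
          \<open>([], True)\<close> of cost 1, hence within \<open>Suc N\<close>.\<close>
        have "obs_linear ar R (Suc N) (\<lambda>u. \<Sum>\<^sub>\<infinity>s \<in> D \<rightarrow>\<^sub>E closed_terms ar.
            weight \<rho> * ?A \<rho> us s D * ?T us E * ?C \<rho> (rule_subst us s) * obs ar R True [] u)"
          by (intro obs_linear_infsum obs_linear_cmult obs_linear_obs) (simp add: tests_def)
        moreover have "?G \<rho> u s =
            weight \<rho> * ?A \<rho> us s D * ?T us E * ?C \<rho> (rule_subst us s) * obs ar R True [] u" for u s
        proof -
          have A: "?A \<rho> (us[i := u]) s D = ?A \<rho> us s D" using 2 by (intro A_upd)
          have T: "?T (us[i := u]) (stops \<rho>) = obs ar R True [] u * ?T us E"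
            using E i len T_upd[OF E(2)] by simp
          have C: "?C \<rho> (rule_subst (us[i := u]) s) = ?C \<rho> (rule_subst us s)"
            using 2 i len by (intro C_cong) (auto simp: V_def nth_list_update split: if_splits)
          show ?thesis
            unfolding D_def[symmetric] A T C by (simp only: ac_simps)
        qed
        ultimately show ?thesis by (simp only:)
      next
        case 3
        \<comment> \<open>Without a premise on position \<open>i\<close>, \<open>u\<close> itself
          enters the target at most once. No step of \<open>u\<close> is spent, so even the bound
          \<open>N\<close> suffices.\<close>
        have "obs_linear ar R N (\<lambda>u. \<Sum>\<^sub>\<infinity>s \<in> D \<rightarrow>\<^sub>E closed_terms ar.
            weight \<rho> * ?A \<rho> us s D * ?T us (stops \<rho>) * ?C \<rho> ((rule_subst us s)(VX i := u)))"
        proof (rule obs_linear_infsum, rule obs_linear_cmult,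
            rule obs_linear_cont[OF Suc.IH concl _ we])
          fix s v assume s: "s \<in> D \<rightarrow>\<^sub>E closed_terms ar" and v: "v \<in> V" "v \<noteq> VX i"
          then show "rule_subst us s v \<in> closed_terms ar"
            using us PiE_mem[OF s] unfolding V_def by auto
        qed
        moreover have "?G \<rho> u s =
            weight \<rho> * ?A \<rho> us s D * ?T us (stops \<rho>) * ?C \<rho> ((rule_subst us s)(VX i := u))" for u s
        proof -
          have A: "?A \<rho> (us[i := u]) s D = ?A \<rho> us s D" using 3 by (intro A_upd)
          have T: "?T (us[i := u]) (stops \<rho>) = ?T us (stops \<rho>)" using 3 by (intro T_upd)
          have C: "?C \<rho> (rule_subst (us[i := u]) s) = ?C \<rho> ((rule_subst us s)(VX i := u))"
            using i len by (intro C_cong) (auto simp: V_def nth_list_update)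
          show ?thesis
            unfolding D_def[symmetric] A T C ..
        qed
        ultimately have "obs_linear ar R N (\<lambda>u. \<Sum>\<^sub>\<infinity>s \<in> D \<rightarrow>\<^sub>E closed_terms ar. ?G \<rho> u s)"
          by (simp only:)
        then show ?thesis by (rule obs_linear_mono) simp
      qed
      then show ?thesis by (simp only: D_def)
    qed
    have "obs_linear ar R (Suc N) (\<lambda>u. \<Sum>\<^sub>\<infinity>\<rho> \<in> {\<rho> \<in> R. head \<rho> = f}.
        \<Sum>\<^sub>\<infinity>s \<in> dom (acts \<rho>) \<rightarrow>\<^sub>E closed_terms ar. ?G \<rho> u s)"
      by (rule obs_linear_infsum, intro rule_linear) auto
    then show ?thesis
    proof (rule obs_linear_cong)
      fix u assume u: "u \<in> closed_terms ar"
      show "obs ar R e w (Fn f (us[i := u])) = (\<Sum>\<^sub>\<infinity>\<rho> \<in> {\<rho> \<in> R. head \<rho> = f}.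
        \<Sum>\<^sub>\<infinity>s \<in> dom (acts \<rho>) \<rightarrow>\<^sub>E closed_terms ar. ?G \<rho> u s)"
        using us u len i by (intro obs_Fn[OF rules _ _ ew]) (auto simp: nth_list_update)
    qed
  qed
  then show ?case by (auto simp: obs_linear_ops_def)
qed

section \<open>Exchange of arguments and congruence\<close>

lemma trace_equiv_Fn_update:
  assumes rules: "\<forall>\<rho>\<in>R. de_simone_rule ar \<rho>" and ast: "almost_surely_terminating ar R"
    and len: "length us = ar f" and i: "i < ar f"
    and us: "\<And>j. j < ar f \<Longrightarrow> us ! j \<in> closed_terms ar"
    and ts: "(us ! i, s) \<in> trace_equiv ar R"
  shows "(Fn f us, Fn f (us[i := s])) \<in> trace_equiv ar R"
proof -
  have s: "s \<in> closed_terms ar" using ts by (simp add: trace_equiv_def)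
  have closed: "Fn f us \<in> closed_terms ar" "Fn f (us[i := s]) \<in> closed_terms ar"
    using us s len i by (auto intro!: closed_terms_Fn simp: nth_list_update)
  have "trace_map ar R (Fn f us) w = trace_map ar R (Fn f (us[i := s])) w" for w
  proof -
    have "(w, True) \<in> tests (Suc (length w))" by (simp add: tests_def)
    then have "obs_linear ar R (Suc (length w)) (\<lambda>u. obs ar R True w (Fn f (us[i := u])))"
      using len i us
      by (intro obs_linear_ops[OF rules, unfolded obs_linear_ops_def, rule_format]) auto
    then obtain c where c: "\<And>u. u \<in> closed_terms ar \<Longrightarrow> obs ar R True w (Fn f (us[i := u])) =
        (\<Sum>\<^sub>\<infinity>q\<in>tests (Suc (length w)). c q * obs ar R (snd q) (fst q) u)"
      unfolding obs_linear_def by blast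
    \<comment> \<open>Since \<open>us\<close> is \<open>us[i := us ! i]\<close>, both sides are
      values of one linear functional at two terms with equal observations.\<close>
    have "obs ar R True w (Fn f (us[i := us ! i])) = obs ar R True w (Fn f (us[i := s]))"
      using us i s by (simp only: c trace_map_determines_obs[OF ast ts])
    then show ?thesis using closed by (simp add: obs_True_eq_trace_map)
  qed
  then show ?thesis using closed by (auto simp: trace_equiv_def)
qed

lemma equiv_trace_equiv: "equiv (closed_terms ar) (trace_equiv ar R)"
  by (rule equivI) (auto simp: trace_equiv_def refl_on_def sym_def trans_def)

theorem theorem42:
  fixes ar :: "'f \<Rightarrow> nat" and R :: "('f, 'l) ds_rule set"
  assumes "prob_de_simone_spec ar R"
    and "almost_surely_terminating ar R"
  shows "congruence ar (trace_equiv ar R)"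
proof -
  have rules: "\<forall>\<rho>\<in>R. de_simone_rule ar \<rho>" using assms(1) by (simp add: prob_de_simone_spec_def)
  have "(Fn f ts, Fn f ss) \<in> trace_equiv ar R"
    if len: "length ts = ar f" "length ss = ar f"
      and eq: "\<And>i. i < ar f \<Longrightarrow> (ts ! i, ss ! i) \<in> trace_equiv ar R" for f ts ss
  proof -
    have closed: "ts ! i \<in> closed_terms ar" "ss ! i \<in> closed_terms ar" if "i < ar f" for i
      using eq[OF that] by (auto simp: trace_equiv_def)
    \<comment> \<open>Hybrid argument lists: the first \<open>k\<close> entries are already those of
      \<open>ss\<close>, the others still those of \<open>ts\<close>.\<close>
    have "(Fn f ts, Fn f (take k ss @ drop k ts)) \<in> trace_equiv ar R" if "k \<le> ar f" for k
      using that
    proof (induction k)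
      case 0
      then show ?case
        using closed len by (auto intro!: closed_terms_Fn simp: trace_equiv_def)
    next
      case (Suc k)
      let ?us = "take k ss @ drop k ts"
      \<comment> \<open>Entry \<open>k\<close> of \<open>?us\<close> is still \<open>ts ! k\<close>,
        so a single exchange leads to the next hybrid.\<close>
      have "(Fn f ?us, Fn f (?us[k := ss ! k])) \<in> trace_equiv ar R"
        using Suc.prems len closed eq
        by (intro trace_equiv_Fn_update[OF rules assms(2)]) (auto simp: nth_append)
      moreover have "?us[k := ss ! k] = take (Suc k) ss @ drop (Suc k) ts"
        using Suc.prems len
        by (simp add: list_update_append take_Suc_conv_app_nth flip: Cons_nth_drop_Suc)
      ultimately show ?case
        using Suc unfolding trace_equiv_def by auto
    qed
    from this[of "ar f"] show ?thesis using len by simp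
  qed
  then show ?thesis
    unfolding congruence_def using equiv_trace_equiv by blast
qed

end
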